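(* Let $k\geq 1$ be an integer. Let $Q_1,\ldots,Q_{2k+1}\geq 1$ and let $B_i\subseteq[1,Q_i]$ be sets of integers for $1\leq i\leq 2k+1$. Then there exists a partition $\{1,\ldots,2k+1\}=X\sqcup Y$ with $|X|=k+1$ and $|Y|=k$ such that the number of tuples of integers $(a_1,\ldots,a_{2k+1},q_1,\ldots,q_{2k+1})$ with $a_i\in B_i$, $1\le q_i\leq Q_i$ and $\gcd(a_i,q_i)=1$ for $1\leq i\leq 2k+1$, such that \[\frac{a_1}{q_1}+\cdots+\frac{a_{2k+1}}{q_{2k+1}}\in\mathbb{Z},\] is \[\ll_k (\log(Q_1\cdots Q_{2k+1}))^{O_k(1)}\left(\prod_{i\in X}|B_i|\right)\left(\prod_{j\in Y}Q_j\right).\]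
   Context: The notation $f\ll_k g$ means $|f|\leq C_k g$ for a constant $C_k$ depending only on $k$; $O_k(1)$ denotes a quantity bounded in terms of $k$ only. *)

theory Defs
  imports Complex_Main "HOL-Library.FuncSet"
begin

text \<open>Tuples indexed by \<open>I\<close> are extensional functions on \<open>I\<close>, so that the cardinality below
  counts each tuple exactly once.\<close>

definition solutions :: "nat set \<Rightarrow> (nat \<Rightarrow> real) \<Rightarrow> (nat \<Rightarrow> int set) \<Rightarrow> ((nat \<Rightarrow> int) \<times> (nat \<Rightarrow> int)) set"
  where "solutions I Q B =
    {(a, q). a \<in> extensional I \<and> q \<in> extensional I \<and>
       (\<forall>i\<in>I. a i \<in> B i \<and> 1 \<le> q i \<and> real_of_int (q i) \<le> Q i \<and> gcd (a i) (q i) = 1) \<and>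
       (\<Sum>i\<in>I. real_of_int (a i) / real_of_int (q i)) \<in> \<int>}"

end

theory Submission
  imports Defs
begin

text \<open>Add the fractions one at a time in some order and let \<open>b / t\<close> be the current partial sum in
  lowest terms. Adding \<open>a / q\<close> replaces the denominator \<open>t = x y g\<close> by \<open>y g z\<close>, where \<open>q = x g z\<close>, and the
  cancellation of \<open>x\<close> means \<open>b z + a y \<equiv> 0 (mod x)\<close>. If the denominator does not decrease, then
  \<open>z \<ge> x\<close>, so \<open>a\<close> may be kept in \<open>B\<close> and the congruence saves a factor \<open>x\<close> in the choice
  of \<open>z\<close>; otherwise \<open>a\<close> runs over \<open>[1, Q]\<close> and the congruence saves \<open>x\<close> in the choice of \<open>a\<close>.
  In both cases the quotients of consecutive denominators telescope. Reversing the order swaps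
  increases and decreases, so as \<open>2 k + 1\<close> is odd, an order or its reverse has at least
  \<open>k + 1\<close> steps without decrease.

  The choice of \<open>x, y, g\<close> costs divisor functions, which are not bounded by powers of logarithms.
  However, if \<open>q\<^sub>i\<close> has the most divisors then some other \<open>q\<^sub>j\<close> has, up to a power, as many,
  because \<open>q\<^sub>i\<close> divides the product of the other denominators. Putting \<open>i\<close> and \<open>j\<close> at the two ends
  of the order, the first denominator, which is unconstrained, always dominates all divisor losses,
  and moments of the divisor function are logarithmic on average.\<close>

section \<open>The divisor function\<close>

definition tau :: "int \<Rightarrow> nat"
  where "tau n = card {d. 0 < d \<and> d dvd n}"

lemma finite_pos_divisors: "0 < (n::int) \<Longrightarrow> finite {d. 0 < d \<and> d dvd n}"
  by (rule finite_subset[of _ "{1..n}"]) (auto dest: zdvd_imp_le)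

lemma tau_ge_1: assumes "0 < n" shows "1 \<le> tau n"
proof -
  have "card {1::int} \<le> tau n"
    unfolding tau_def using assms by (intro card_mono finite_pos_divisors) auto
  then show ?thesis by simp
qed

lemma tau_mono: "m dvd n \<Longrightarrow> 0 < n \<Longrightarrow> tau m \<le> tau n"
  unfolding tau_def by (intro card_mono finite_pos_divisors) (auto intro: dvd_trans)

text \<open>A divisor of \<open>m * n\<close> splits, in at least one way, into a divisor of
  \<open>m\<close> times a divisor of \<open>n\<close>, so multiplication maps the pairs of divisors
  onto a set containing all divisors of the product.\<close>

lemma tau_mult_le:
  assumes "0 < m" "0 < n" shows "tau (m * n) \<le> tau m * tau n"
proof -
  let ?D = "\<lambda>n::int. {d. 0 < d \<and> d dvd n}"
  have "?D (m * n) \<subseteq> (\<lambda>(a, b). a * b) ` (?D m \<times> ?D n)"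
  proof
    fix d assume d: "d \<in> ?D (m * n)"
    then obtain a b where ab: "d = a * b" "a dvd m" "b dvd n"
      using division_decomp by blast
    with d have "d = \<bar>a\<bar> * \<bar>b\<bar>" "a \<noteq> 0" "b \<noteq> 0" by (auto simp: abs_mult[symmetric])
    then show "d \<in> (\<lambda>(a, b). a * b) ` (?D m \<times> ?D n)"
      using ab by (intro image_eqI[of _ _ "(\<bar>a\<bar>, \<bar>b\<bar>)"]) auto
  qed
  then have "card (?D (m * n)) \<le> card ((\<lambda>(a, b). a * b) ` (?D m \<times> ?D n))"
    using assms by (intro card_mono finite_imageI finite_cartesian_product finite_pos_divisors)
  also have "\<dots> \<le> card (?D m \<times> ?D n)"
    using assms by (intro card_image_le finite_cartesian_product finite_pos_divisors)
  finally show ?thesis by (simp add: tau_def card_cartesian_product)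
qed

lemma tau_prod_le:
  assumes "finite A" "\<And>i. i \<in> A \<Longrightarrow> 0 < q i"
  shows "tau (\<Prod>i\<in>A. q i) \<le> (\<Prod>i\<in>A. tau (q i))"
  using assms
proof (induction A rule: finite_induct)
  case empty
  have "{d::int. 0 < d \<and> d dvd 1} = {1}" by auto
  then show ?case by (simp add: tau_def)
next
  case (insert i A)
  have "tau (q i * (\<Prod>i\<in>A. q i)) \<le> tau (q i) * tau (\<Prod>i\<in>A. q i)"
    using insert by (intro tau_mult_le) (auto intro!: prod_pos)
  also have "\<dots> \<le> tau (q i) * (\<Prod>i\<in>A. tau (q i))"
    using insert by (intro mult_left_mono) auto
  finally show ?case using insert by simp
qed

section \<open>Logarithmic moments of the divisor function\<close>

lemma sum_inverse_le_ln:
  assumes "1 \<le> (N::int)"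
  shows "(\<Sum>q\<in>{1..N}. 1 / real_of_int q) \<le> 1 + ln (real_of_int N)"
  using assms
proof (induction N rule: int_ge_induct)
  case base
  then show ?case by simp
next
  case (step N)
  have "{1..N + 1} = insert (N + 1) {1..N}" using step by auto
  then have "(\<Sum>q\<in>{1..N+1}. 1 / real_of_int q) = 1 / (N + 1) + (\<Sum>q\<in>{1..N}. 1 / real_of_int q)"
    by simp
  moreover have "1 / (real_of_int N + 1) \<le> ln (real_of_int N + 1) - ln (real_of_int N)"
  proof -
    have "ln (real_of_int N / (N + 1)) \<le> real_of_int N / (N + 1) - 1"
      using step by (intro ln_le_minus_one) auto
    also have "\<dots> = - (1 / (real_of_int N + 1))" using step by (simp add: field_simps)
    finally show ?thesis using step by (simp add: ln_div)
  qed
  ultimately show ?case using step by simp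
qed

text \<open>One factor \<open>tau q\<close> is spent on a sum over the factorisations
  \<open>q = d * e\<close>. Submultiplicativity splits the remaining power, and dropping the
  constraint \<open>d * e \<le> N\<close> leaves a product of two equal sums.\<close>

lemma sum_tau_power_le_square:
  assumes "1 \<le> (N::int)"
  shows "(\<Sum>q\<in>{1..N}. real (tau q) ^ Suc m / real_of_int q)
    \<le> (\<Sum>q\<in>{1..N}. real (tau q) ^ m / real_of_int q)\<^sup>2"
proof -
  let ?D = "\<lambda>n::int. {d. 0 < d \<and> d dvd n}"
  let ?h = "\<lambda>q. real (tau q) ^ m / real_of_int q"
  let ?r = "\<lambda>(q, d). (d, q div d)"
  have "(\<Sum>q\<in>{1..N}. real (tau q) ^ Suc m / real_of_int q) = (\<Sum>q\<in>{1..N}. \<Sum>d\<in>?D q. ?h q)"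
    by (simp add: tau_def)
  also have "\<dots> = (\<Sum>(q, d)\<in>Sigma {1..N} ?D. ?h q)"
    by (rule sum.Sigma) (auto intro: finite_pos_divisors)
  also have "\<dots> \<le> (\<Sum>p\<in>Sigma {1..N} ?D. (\<lambda>(d, e). ?h d * ?h e) (?r p))"
  proof (rule sum_mono, clarsimp)
    fix q d :: int assume q: "1 \<le> q" "q \<le> N" "0 < d" "d dvd q"
    then obtain e where e: "q = d * e" by auto
    with q have "0 < e" by (metis less_le_trans zero_less_mult_pos zero_less_one)
    have "real (tau q) ^ m \<le> (real (tau d) * real (tau e)) ^ m"
      using tau_mult_le[OF \<open>0 < d\<close> \<open>0 < e\<close>] unfolding e
      by (intro power_mono) (auto simp flip: of_nat_mult)
    then show "?h q \<le> real (tau d) ^ m * real (tau (q div d)) ^ m / (real_of_int d * real_of_int (q div d))"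
      using q e \<open>0 < e\<close> by (simp add: power_mult_distrib divide_right_mono)
  qed
  also have "\<dots> = (\<Sum>p\<in>?r ` Sigma {1..N} ?D. (\<lambda>(d, e). ?h d * ?h e) p)"
    by (rule sum.reindex[symmetric, unfolded o_def]) (auto simp: inj_on_def)
  also have "\<dots> \<le> (\<Sum>p\<in>{1..N}\<times>{1..N}. (\<lambda>(d, e). ?h d * ?h e) p)"
  proof (rule sum_mono2)
    show "?r ` Sigma {1..N} ?D \<subseteq> {1..N} \<times> {1..N}"
    proof
      fix v assume "v \<in> ?r ` Sigma {1..N} ?D"
      then obtain q d where v: "v = (d, q div d)" and q: "1 \<le> q" "q \<le> N" "0 < d" "d dvd q" by auto
      then obtain e where e: "q = d * e" by auto
      with q have "0 < e" by (metis less_le_trans zero_less_mult_pos zero_less_one)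
      moreover from e have "e dvd q" by simp
      ultimately have "d \<le> q" "e \<le> q" using q by (auto intro: zdvd_imp_le)
      moreover have "v = (d, e)" using v e q by simp
      ultimately show "v \<in> {1..N} \<times> {1..N}" using q(2,3) \<open>0 < e\<close> by simp
    qed
  qed auto
  also have "\<dots> = (\<Sum>q\<in>{1..N}. ?h q)\<^sup>2"
    by (simp add: power2_eq_square sum_product sum.cartesian_product)
  finally show ?thesis .
qed

text \<open>Each further moment squares the previous bound, beginning with the harmonic sum; hence
  the exponent \<open>2 ^ m\<close>.\<close>

lemma sum_tau_power_le:
  assumes "1 \<le> (N::int)"
  shows "(\<Sum>q\<in>{1..N}. real (tau q) ^ m / real_of_int q) \<le> (1 + ln (real_of_int N)) ^ (2 ^ m)"
proof (induction m)
  case 0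
  then show ?case using sum_inverse_le_ln[OF assms] by simp
next
  case (Suc m)
  have "(\<Sum>q\<in>{1..N}. real (tau q) ^ Suc m / real_of_int q)
      \<le> (\<Sum>q\<in>{1..N}. real (tau q) ^ m / real_of_int q)\<^sup>2"
    by (rule sum_tau_power_le_square[OF assms])
  also have "\<dots> \<le> ((1 + ln (real_of_int N)) ^ (2 ^ m))\<^sup>2"
    by (intro power_mono Suc sum_nonneg) auto
  finally show ?case by (simp add: mult.commute flip: power_mult)
qed

section \<open>Denominators of sums of fractions\<close>

definition denom :: "rat \<Rightarrow> int"
  where "denom s = snd (quotient_of s)"

lemma denom_pos: "0 < denom s"
  by (simp add: denom_def quotient_of_denom_pos')

lemma denom_divide:
  assumes "coprime a q" "0 < q" shows "denom (of_int a / of_int q) = q"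
proof -
  have "quotient_of (Fract a q) = (a, q)" using assms by (simp add: quotient_of_Fract normalize_stable)
  then show ?thesis by (simp add: denom_def Fract_of_int_quotient)
qed

lemma rat_reduced:
  obtains b where "s = of_int b / of_int (denom s)" "coprime b (denom s)"
proof -
  obtain b d where bd: "quotient_of s = (b, d)" by fastforce
  then show ?thesis
    using quotient_of_div[OF bd] quotient_of_coprime[OF bd] that[of b] by (simp add: denom_def)
qed

lemma denom_dvd:
  assumes "0 < q" shows "denom (of_int a / of_int q) dvd q"
proof -
  define g where "g = gcd a q"
  have g: "g \<noteq> 0" "g > 0" using assms by (auto simp: g_def)
  obtain a' q' where aq: "a = a' * g" "q = q' * g" "coprime a' q'"
    using gcd_coprime_exists[of a q] g(1) unfolding g_def by blast
  have "0 < q'" using aq g assms by (simp add: zero_less_mult_iff)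
  have "(of_int a / of_int q :: rat) = of_int a' / of_int q'"
    using aq g by simp
  then show ?thesis using denom_divide[OF aq(3) \<open>0 < q'\<close>] aq(2) by simp
qed

lemma denom_add_dvd: "denom (r + s) dvd denom r * denom s"
proof -
  obtain a where a: "r = of_int a / of_int (denom r)" using rat_reduced by blast
  obtain b where b: "s = of_int b / of_int (denom s)" using rat_reduced by blast
  have "r + s = of_int (a * denom s + b * denom r) / of_int (denom r * denom s)"
    using denom_pos[of r] denom_pos[of s] by (subst a, subst b) (simp add: field_simps)
  then show ?thesis by (metis denom_dvd denom_pos mult_pos_pos)
qed

lemma denom_uminus: "denom (- s) = denom s"
proof -
  obtain a where a: "s = of_int a / of_int (denom s)" "coprime a (denom s)" using rat_reduced by blast
  have "- s = of_int (- a) / of_int (denom s)" by (subst a) simp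
  then show ?thesis using denom_divide[of "- a" "denom s"] a denom_pos by simp
qed

lemma denom_of_int: "denom (of_int m) = 1"
  using denom_divide[of m 1] by simp

lemma denom_eq_1_iff: "denom s = 1 \<longleftrightarrow> s \<in> \<int>"
proof
  assume "denom s = 1"
  then show "s \<in> \<int>" using rat_reduced[of s] by (metis Ints_of_int div_by_1 of_int_1)
qed (auto elim!: Ints_cases simp: denom_of_int)

text \<open>Complementary partial sums of an integer total are negatives of each other modulo 1;
  together with \<open>denom_uminus\<close> this equates their denominators.\<close>

lemma denom_add_int:
  assumes "m \<in> \<int>" shows "denom (m + s) = denom s"
proof (rule zdvd_antisym_nonneg)
  have 1: "denom m = 1" "denom (- m) = 1" using assms by (auto simp: denom_eq_1_iff)
  show "denom (m + s) dvd denom s" using denom_add_dvd[of m s] 1 by simp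
  show "denom s dvd denom (m + s)" using denom_add_dvd[of "- m" "m + s"] 1 by simp
qed (use denom_pos in \<open>auto intro: less_imp_le\<close>)

lemma denom_sum_dvd:
  assumes "finite A" shows "denom (\<Sum>i\<in>A. r i) dvd (\<Prod>i\<in>A. denom (r i))"
  using assms
proof (induction A rule: finite_induct)
  case empty
  then show ?case using denom_of_int[of 0] by simp
next
  case (insert i A)
  then show ?case
    using dvd_trans[OF denom_add_dvd[of "r i" "\<Sum>i\<in>A. r i"] mult_dvd_mono[OF dvd_refl insert.IH]]
    by simp
qed

text \<open>Over the common denominator \<open>y * z * gcd t q\<close> the numerator is
  \<open>b * z + a * y\<close>, which is coprime to \<open>y\<close> and to \<open>z\<close>. So
  everything that cancels lies in \<open>gcd t q\<close>; \<open>x\<close> is this cancelled part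
  and \<open>g\<close> the rest. The coprimality of \<open>x\<close> to \<open>b\<close> and to
  \<open>y\<close> is recorded so that the congruence can be solved for \<open>z\<close> or for
  \<open>a\<close>.\<close>

lemma denom_add_structure:
  fixes a b q t :: int
  assumes "coprime b t" "coprime a q" "0 < t" "0 < q"
  obtains x y g z where "0 < x" "0 < y" "0 < g" "0 < z" "t = x * y * g" "q = x * g * z"
    "denom (of_int b / of_int t + of_int a / of_int q) = y * g * z"
    "x dvd b * z + a * y" "coprime b x" "coprime y x"
proof -
  obtain y z where yz: "t = y * gcd t q" "q = z * gcd t q" "coprime y z"
    using gcd_coprime_exists[of t q] assms by auto
  have g0: "0 < gcd t q" using assms by simp
  define x where "x = gcd (b * z + a * y) (gcd t q)"
  have x: "0 < x" using g0 by (simp add: x_def)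
  obtain m g where mg: "b * z + a * y = m * x" "gcd t q = g * x" "coprime m g"
    using gcd_coprime_exists[of "b * z + a * y" "gcd t q"] x unfolding x_def by auto
  have g: "0 < g" using mg g0 x by (simp add: zero_less_mult_iff)
  have y: "0 < y" and z: "0 < z"
    using yz g0 assms by (metis zero_less_mult_pos2)+
  have t: "t = x * y * g" and q: "q = x * g * z" using yz mg by (metis mult.commute mult.left_commute)+
  have cop: "coprime b x" "coprime b y" "coprime a x" "coprime a z"
    using assms t q by auto
  have "coprime (b * z + a * y) y"
  proof -
    have "coprime (b * z) y" using cop yz by (simp add: coprime_commute)
    then show ?thesis using gcd_add_mult[of y a "b * z"]
      by (simp add: coprime_iff_gcd_eq_1 gcd.commute add.commute)
  qed
  moreover have "coprime (b * z + a * y) z"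
  proof -
    have "coprime (a * y) z" using cop yz by (simp add: coprime_commute)
    then show ?thesis using gcd_add_mult[of z b "a * y"]
      by (simp add: coprime_iff_gcd_eq_1 gcd.commute add.commute)
  qed
  ultimately have "coprime m y" "coprime m z" using mg(1) by auto
  with mg(3) have cm: "coprime m (y * g * z)" by simp
  have "(of_int b / of_int t + of_int a / of_int q :: rat) = of_int (b * z + a * y) / of_int (x * y * g * z)"
    using x y g z unfolding t q by (simp add: field_simps)
  also have "\<dots> = of_int m / of_int (y * g * z)"
    using x y g z unfolding mg(1) by (simp add: field_simps)
  finally have "denom (of_int b / of_int t + of_int a / of_int q) = y * g * z"
    using denom_divide[OF cm] y g z by simp
  \<comment> \<open>A common divisor of \<open>y\<close> and \<open>x\<close> divides
    \<open>b * z\<close> and is coprime to \<open>b\<close>, so it divides \<open>z\<close>, which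
    is coprime to \<open>y\<close>.\<close>
  moreover have "coprime y x"
  proof (rule coprimeI)
    fix c assume c: "c dvd y" "c dvd x"
    have "x dvd b * z + a * y" using mg(1) by simp
    then have "c dvd b * z" using c by (meson dvd_add_left_iff dvd_mult dvd_trans)
    moreover have "coprime c b" using cop(1) c(2) by (metis coprime_commute coprime_divisors dvd_refl)
    ultimately have "c dvd z" by (simp add: coprime_dvd_mult_right_iff)
    then show "is_unit c" using c yz(3) coprime_common_divisor by blast
  qed
  ultimately show thesis using that[OF x y g z t q] cop mg(1) by simp
qed

section \<open>Adding one fraction\<close>

text \<open>On one residue class modulo \<open>x\<close> the quotient \<open>z div x\<close>
  determines \<open>z\<close>, and \<open>x \<le> z\<close> makes it positive. The sum is thus at
  most \<open>1 / x\<close> times a harmonic sum; an element below \<open>x\<close> would destroy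
  this saving.\<close>

lemma sum_inverse_class_le:
  fixes x N :: int
  assumes "Z \<subseteq> {x..N}" "0 < x" "1 \<le> N" and cong: "\<And>z z'. z \<in> Z \<Longrightarrow> z' \<in> Z \<Longrightarrow> x dvd z - z'"
  shows "(\<Sum>z\<in>Z. 1 / real_of_int z) \<le> (1 + ln (real_of_int N)) / real_of_int x"
proof -
  have inj: "inj_on (\<lambda>z. z div x) Z"
  proof (rule inj_onI)
    fix z z' assume z: "z \<in> Z" "z' \<in> Z" "z div x = z' div x"
    then have "z mod x = z' mod x" using cong by (simp add: mod_eq_dvd_iff)
    with z(3) show "z = z'" by (metis div_mult_mod_eq)
  qed
  have img: "(\<lambda>z. z div x) ` Z \<subseteq> {1..N}"
  proof clarsimp
    fix z assume "z \<in> Z"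
    then have z: "x \<le> z" "z \<le> N" using assms(1) by auto
    have "1 \<le> z div x" using z assms(2) by (simp add: int_one_le_iff_zero_less pos_imp_zdiv_pos_iff)
    moreover have "z div x \<le> z" using z assms(2) by (intro zdiv_mono2[of z 1 x, simplified]) auto
    ultimately show "1 \<le> z div x \<and> z div x \<le> N" using z by simp
  qed
  have "(\<Sum>z\<in>Z. 1 / real_of_int z) \<le> (\<Sum>z\<in>Z. 1 / real_of_int (z div x) / real_of_int x)"
  proof (rule sum_mono)
    fix z assume "z \<in> Z"
    then have "1 \<le> z div x" using img by auto
    moreover have "(z div x) * x \<le> z"
      using assms(2) by (metis add.commute le_add_same_cancel1 minus_mod_eq_div_mult mod_div_mult_eq pos_mod_sign le_add_same_cancel2)
    ultimately have "0 < real_of_int (z div x) * real_of_int x" "real_of_int (z div x) * real_of_int x \<le> real_of_int z"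
      using assms(2) by (auto simp flip: of_int_mult)
    then show "1 / real_of_int z \<le> 1 / real_of_int (z div x) / real_of_int x"
      by (simp add: frac_le)
  qed
  also have "\<dots> = (\<Sum>z\<in>Z. 1 / real_of_int (z div x)) / real_of_int x"
    by (simp add: sum_divide_distrib)
  also have "(\<Sum>z\<in>Z. 1 / real_of_int (z div x)) = (\<Sum>j\<in>(\<lambda>z. z div x) ` Z. 1 / real_of_int j)"
    by (simp add: sum.reindex[OF inj])
  also have "\<dots> \<le> (\<Sum>j\<in>{1..N}. 1 / real_of_int j)"
    using img by (intro sum_mono2) auto
  also have "\<dots> \<le> 1 + ln (real_of_int N)" by (rule sum_inverse_le_ln[OF assms(3)])
  finally show ?thesis using assms(2) by (simp add: divide_right_mono)
qed

text \<open>A class has at most \<open>N div x + 1\<close> elements here, and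
  \<open>x \<le> N\<close> absorbs the extra 1 at the price of the factor 2.\<close>

lemma card_class_le:
  fixes x N :: int
  assumes "A \<subseteq> {1..N}" "0 < x" "x \<le> N" and cong: "\<And>z z'. z \<in> A \<Longrightarrow> z' \<in> A \<Longrightarrow> x dvd z - z'"
  shows "real (card A) \<le> 2 * real_of_int N / real_of_int x"
proof -
  have inj: "inj_on (\<lambda>z. z div x) A"
  proof (rule inj_onI)
    fix z z' assume z: "z \<in> A" "z' \<in> A" "z div x = z' div x"
    then have "z mod x = z' mod x" using cong by (simp add: mod_eq_dvd_iff)
    with z(3) show "z = z'" by (metis div_mult_mod_eq)
  qed
  have "(\<lambda>z. z div x) ` A \<subseteq> {0..N div x}"
    using assms(1,2) by (auto simp: pos_imp_zdiv_nonneg_iff intro!: zdiv_mono1)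
  then have "card ((\<lambda>z. z div x) ` A) \<le> card {0..N div x}" by (intro card_mono) auto
  then have "card A \<le> nat (N div x + 1)" by (simp add: card_image[OF inj])
  moreover have "1 \<le> N div x" using assms by (simp add: int_one_le_iff_zero_less pos_imp_zdiv_pos_iff)
  ultimately have "real (card A) \<le> 2 * real_of_int (N div x)" by linarith
  also have "real_of_int (N div x) \<le> real_of_int N / real_of_int x"
    by (metis floor_divide_of_int_eq of_int_floor_le)
  finally show ?thesis by simp
qed

text \<open>\<open>U\<close> marks a step that does not decrease the denominator. If it holds,
  \<open>a\<close> is fixed first, and since \<open>b\<close> is invertible modulo \<open>x\<close>
  the congruence confines \<open>z\<close> to one class. Otherwise \<open>z\<close> is fixed first,
  and since \<open>y\<close> is invertible \<open>a\<close> is confined to one class.\<close>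

lemma sum_inverse_pairs_le:
  fixes b x y N :: int
  assumes "B \<subseteq> {1..N}" "0 < x" "x \<le> N" "coprime b x" "coprime y x"
  shows "(\<Sum>(a, z) | a \<in> B \<and> z \<in> {1..N} \<and> x dvd b * z + a * y \<and> (U \<longrightarrow> x \<le> z). 1 / real_of_int z)
    \<le> (if U then real (card B) else 2 * real_of_int N) * (1 + ln (real_of_int N)) / real_of_int x"
proof -
  let ?T = "{(a, z). a \<in> B \<and> z \<in> {1..N} \<and> x dvd b * z + a * y \<and> (U \<longrightarrow> x \<le> z)}"
  have fB: "finite B" using assms(1) finite_subset by blast
  have N: "1 \<le> N" using assms by simp
  then have lN: "0 \<le> ln (real_of_int N)" by simp
  show ?thesis
  proof (cases U)
    case True
    let ?Z = "\<lambda>a. {z \<in> {x..N}. x dvd b * z + a * y}"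
    have "?T = Sigma B ?Z" using True assms(2) by auto
    then have "(\<Sum>(a, z)\<in>?T. 1 / real_of_int z) = (\<Sum>(a, z)\<in>Sigma B ?Z. 1 / real_of_int z)"
      by simp
    also have "\<dots> = (\<Sum>a\<in>B. \<Sum>z\<in>?Z a. 1 / real_of_int z)"
      by (rule sum.Sigma[symmetric]) (use fB in \<open>auto intro: finite_subset[of _ "{x..N}"]\<close>)
    also have "\<dots> \<le> (\<Sum>a\<in>B. (1 + ln (real_of_int N)) / real_of_int x)"
    proof (intro sum_mono sum_inverse_class_le)
      fix a z z' assume "z \<in> ?Z a" "z' \<in> ?Z a"
      then have "x dvd (b * z + a * y) - (b * z' + a * y)" by (intro dvd_diff) auto
      then have "x dvd b * (z - z')" by (simp add: algebra_simps)
      then show "x dvd z - z'" using assms(4) by (simp add: coprime_dvd_mult_right_iff coprime_commute)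
    qed (use assms N in auto)
    finally show ?thesis using True by simp
  next
    case False
    let ?A = "\<lambda>z. {a \<in> B. x dvd b * z + a * y}"
    have "(\<Sum>(a, z)\<in>?T. 1 / real_of_int z) = (\<Sum>(z, a)\<in>Sigma {1..N} ?A. 1 / real_of_int z)"
      by (rule sum.reindex_bij_witness[of _ prod.swap prod.swap]) (use False in auto)
    also have "\<dots> = (\<Sum>z\<in>{1..N}. \<Sum>a\<in>?A z. 1 / real_of_int z)"
      by (rule sum.Sigma[symmetric]) (use fB in auto)
    also have "\<dots> = (\<Sum>z\<in>{1..N}. real (card (?A z)) * (1 / real_of_int z))" by simp
    also have "\<dots> \<le> (\<Sum>z\<in>{1..N}. 2 * real_of_int N / real_of_int x * (1 / real_of_int z))"
    proof (intro sum_mono mult_right_mono card_class_le)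
      fix z a a' assume "a \<in> ?A z" "a' \<in> ?A z"
      then have "x dvd (b * z + a * y) - (b * z + a' * y)" by (intro dvd_diff) auto
      then have "x dvd y * (a - a')" by (simp add: algebra_simps)
      then show "x dvd a - a'" using assms(5) by (simp add: coprime_dvd_mult_right_iff coprime_commute)
    qed (use assms N in auto)
    also have "\<dots> = 2 * real_of_int N / real_of_int x * (\<Sum>z\<in>{1..N}. 1 / real_of_int z)"
      by (simp add: sum_distrib_left)
    also have "\<dots> \<le> 2 * real_of_int N / real_of_int x * (1 + ln (real_of_int N))"
      using assms N by (intro mult_left_mono sum_inverse_le_ln) auto
    finally show ?thesis using False by simp
  qed
qed

section \<open>The cost of a single step\<close>

definition frac_of :: "int \<times> int \<Rightarrow> rat"
  where "frac_of p = of_int (fst p) / of_int (snd p)"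

definition reduced_pairs :: "int set \<Rightarrow> int \<Rightarrow> (int \<times> int) set"
  where "reduced_pairs B N = {(a, q). a \<in> B \<and> q \<in> {1..N} \<and> coprime a q}"

lemma finite_reduced_pairs: "finite B \<Longrightarrow> finite (reduced_pairs B N)"
  by (rule finite_subset[of _ "B \<times> {1..N}"]) (auto simp: reduced_pairs_def)

lemma denom_frac_of: "p \<in> reduced_pairs B N \<Longrightarrow> denom (frac_of p) = snd p"
  by (auto simp: reduced_pairs_def frac_of_def denom_divide)

text \<open>The factor 2 is the one lost in \<open>card_class_le\<close>.\<close>

definition step_cost :: "bool \<Rightarrow> int set \<Rightarrow> int \<Rightarrow> real"
  where "step_cost U B N = (if U then real (card B) else 2 * real_of_int N)"

text \<open>The terms are grouped by the pair \<open>(x, g)\<close> of divisors of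
  \<open>denom s\<close>, which leaves at most \<open>tau (denom s) ^ 2\<close> groups. Within a
  group the new denominator is \<open>y * g * z\<close> with \<open>y * g\<close> fixed, and the
  congruence modulo \<open>x\<close> saves a further \<open>x\<close>; as
  \<open>x * y * g = denom s\<close>, the old denominator appears in the bound.\<close>

lemma step_bound:
  assumes B: "B \<subseteq> {1..N}" and N: "1 \<le> N"
  shows "(\<Sum>p | p \<in> reduced_pairs B N \<and> (U \<longrightarrow> denom s \<le> denom (s + frac_of p)).
      1 / real_of_int (denom (s + frac_of p)))
    \<le> real (tau (denom s)) ^ 2 * (step_cost U B N * (1 + ln (real_of_int N)) / real_of_int (denom s))"
    (is "sum ?h ?E \<le> _ * ?c")
proof -
  define t where "t = denom s"
  have t: "0 < t" by (simp add: t_def denom_pos)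
  obtain b where b: "s = of_int b / of_int t" "coprime b t" unfolding t_def using rat_reduced by blast
  have fB: "finite B" using B finite_subset by blast
  have fE: "finite ?E" using finite_reduced_pairs[OF fB] by simp
  let ?D = "{d. 0 < d \<and> d dvd t}"
  define good where "good p x g y z \<longleftrightarrow> 0 < x \<and> 0 < y \<and> 0 < g \<and> 0 < z \<and> t = x * y * g \<and> snd p = x * g * z \<and>
    denom (s + frac_of p) = y * g * z \<and> x dvd b * z + fst p * y \<and> coprime b x \<and> coprime y x" for p x g y z
  have "\<exists>x g y z. good p x g y z" if "p \<in> ?E" for p
  proof -
    have p: "coprime (fst p) (snd p)" "0 < snd p" using that by (auto simp: reduced_pairs_def)
    show ?thesis unfolding good_def b(1) frac_of_def
      by (rule denom_add_structure[OF b(2) p(1) t p(2)]) blast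
  qed
  then obtain X G where XG: "\<And>p. p \<in> ?E \<Longrightarrow> \<exists>y z. good p (X p) (G p) y z" by metis
  \<comment> \<open>Given \<open>x\<close> and \<open>g\<close>, the remaining factors are quotients
    of \<open>t\<close> and of the denominator of \<open>p\<close>, so a fibre of
    \<open>\<phi>\<close> embeds into the pairs \<open>(a, z)\<close> subject to the
    congruence.\<close>
  define \<phi> where "\<phi> p = (X p, G p)" for p
  have fib: "(\<Sum>p\<in>{p \<in> ?E. \<phi> p = w}. ?h p) \<le> ?c" for w
  proof (cases "{p \<in> ?E. \<phi> p = w} = {}")
    case True
    have "0 \<le> ?c" using N denom_pos[of s]
      by (auto simp: step_cost_def intro!: divide_nonneg_pos mult_nonneg_nonneg add_nonneg_nonneg)
    then show ?thesis by (simp only: True sum.empty)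
  next
    case False
    obtain x g where w: "w = (x, g)" by fastforce
    define y where "y = t div (x * g)"
    have good: "good p x g y (snd p div (x * g))" if p: "p \<in> {p \<in> ?E. \<phi> p = w}" for p
    proof -
      from p obtain y' z' where "good p x g y' z'" using XG[of p] by (auto simp: w \<phi>_def)
      moreover from this have "y' = y" "z' = snd p div (x * g)" by (auto simp: good_def y_def)
      ultimately show ?thesis by simp
    qed
    \<comment> \<open>A member of the fibre is needed to know that \<open>x\<close>,
      \<open>y\<close>, \<open>g\<close> have the required properties and that \<open>x\<close>,
      dividing a denominator, is at most \<open>N\<close>.\<close>
    obtain p0 where p0: "p0 \<in> {p \<in> ?E. \<phi> p = w}" using False by blast
    note g0 = good[OF p0, unfolded good_def]
    have xN: "x \<le> N"
    proof -
      have "x dvd snd p0" using g0 by (metis dvd_triv_left mult.assoc)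
      moreover have "0 < snd p0" "snd p0 \<le> N" using p0 by (auto simp: reduced_pairs_def)
      ultimately show ?thesis using zdvd_imp_le by fastforce
    qed
    let ?T = "{(a, z). a \<in> B \<and> z \<in> {1..N} \<and> x dvd b * z + a * y \<and> (U \<longrightarrow> x \<le> z)}"
    let ?\<psi> = "\<lambda>p. (fst p, snd p div (x * g))"
    have inj: "inj_on ?\<psi> {p \<in> ?E. \<phi> p = w}"
    proof (rule inj_onI)
      fix p p' assume pp: "p \<in> {p \<in> ?E. \<phi> p = w}" "p' \<in> {p \<in> ?E. \<phi> p = w}" "?\<psi> p = ?\<psi> p'"
      have "snd p = x * g * (snd p div (x * g))" "snd p' = x * g * (snd p' div (x * g))"
        using good[OF pp(1)] good[OF pp(2)] unfolding good_def by blast+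
      with pp(3) show "p = p'" by (simp add: prod_eq_iff)
    qed
    have img: "?\<psi> ` {p \<in> ?E. \<phi> p = w} \<subseteq> ?T"
    proof
      fix v assume "v \<in> ?\<psi> ` {p \<in> ?E. \<phi> p = w}"
      then obtain p where p: "p \<in> {p \<in> ?E. \<phi> p = w}" and v: "v = ?\<psi> p" by blast
      define z where "z = snd p div (x * g)"
      note gp = good[OF p, unfolded good_def, folded z_def]
      have "z dvd snd p" using gp by simp
      moreover have "0 < snd p" "snd p \<le> N" using p by (auto simp: reduced_pairs_def)
      ultimately have "z \<le> N" using zdvd_imp_le[of z "snd p"] by linarith
      \<comment> \<open>Comparing \<open>t = x * y * g\<close> with the new denominator
        \<open>y * g * z\<close>, non-decrease amounts to \<open>x \<le> z\<close>.\<close>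
      moreover have "x \<le> z" if U
      proof -
        have "t \<le> y * g * z" using p that gp by (simp add: t_def)
        then have "(y * g) * x \<le> (y * g) * z" using gp by (simp add: ac_simps)
        moreover have "0 < y * g" using gp by simp
        ultimately show ?thesis using mult_le_cancel_left_pos by blast
      qed
      ultimately show "v \<in> ?T" using gp p unfolding v z_def[symmetric] by (auto simp: reduced_pairs_def)
    qed
    have fT: "finite ?T" by (rule finite_subset[of _ "B \<times> {1..N}"]) (use fB in auto)
    have yg: "0 < real_of_int (y * g)" using g0 by simp
    have "(\<Sum>p\<in>{p \<in> ?E. \<phi> p = w}. ?h p)
        = (\<Sum>p\<in>{p \<in> ?E. \<phi> p = w}. (\<lambda>(a, z). 1 / real_of_int z) (?\<psi> p) / real_of_int (y * g))"
    proof (rule sum.cong[OF refl])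
      fix p assume "p \<in> {p \<in> ?E. \<phi> p = w}"
      from good[OF this] have "denom (s + frac_of p) = y * g * (snd p div (x * g))"
        unfolding good_def by blast
      then show "?h p = (\<lambda>(a, z). 1 / real_of_int z) (?\<psi> p) / real_of_int (y * g)"
        by (simp only: split fst_conv snd_conv of_int_mult) (simp add: field_simps)
    qed
    also have "\<dots> = (\<Sum>v\<in>?\<psi> ` {p \<in> ?E. \<phi> p = w}. (\<lambda>(a, z). 1 / real_of_int z) v) / real_of_int (y * g)"
      by (simp only: sum.reindex[OF inj] o_def sum_divide_distrib)
    also have "\<dots> \<le> (\<Sum>(a, z)\<in>?T. 1 / real_of_int z) / real_of_int (y * g)"
      using yg img fT by (intro divide_right_mono sum_mono2) auto
    also have "\<dots> \<le> (step_cost U B N * (1 + ln (real_of_int N)) / real_of_int x) / real_of_int (y * g)"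
      unfolding step_cost_def using yg g0 xN by (intro divide_right_mono sum_inverse_pairs_le[OF B]) auto
    also have "\<dots> = ?c" using g0 unfolding t_def[symmetric] by (simp add: ac_simps)
    finally show ?thesis .
  qed
  have "sum ?h ?E = (\<Sum>w\<in>?D \<times> ?D. \<Sum>p\<in>{p \<in> ?E. \<phi> p = w}. ?h p)"
  proof (rule sum.group[symmetric, OF fE])
    show "finite (?D \<times> ?D)" using t by (intro finite_cartesian_product finite_pos_divisors)
    show "\<phi> ` ?E \<subseteq> ?D \<times> ?D"
    proof
      fix w assume "w \<in> \<phi> ` ?E"
      then obtain p where p: "p \<in> ?E" "w = \<phi> p" by blast
      from XG[OF p(1)] show "w \<in> ?D \<times> ?D" unfolding p(2) \<phi>_def good_def by auto
    qed
  qed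
  also have "\<dots> \<le> (\<Sum>w\<in>?D \<times> ?D. ?c)" by (intro sum_mono fib)
  also have "\<dots> = real (tau (denom s)) ^ 2 * ?c"
    by (simp add: card_cartesian_product tau_def t_def power2_eq_square)
  finally show ?thesis .
qed

section \<open>Weighted counting along an order of the fractions\<close>

text \<open>The weight pays for the choice of a factorisation of each intermediate denominator; the steps
  in \<open>X\<close> are required not to decrease the denominator.\<close>

primrec path_weight :: "'i set \<Rightarrow> 'i list \<Rightarrow> ('i \<Rightarrow> int \<times> int) \<Rightarrow> rat \<Rightarrow> real" where
  "path_weight X [] f s = (if denom s = 1 then 1 else 0)"
| "path_weight X (i # L) f s =
    (if i \<in> X \<longrightarrow> denom s \<le> denom (s + frac_of (f i))
     then path_weight X L f (s + frac_of (f i)) / real (tau (denom s)) ^ 2 else 0)"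

lemma path_weight_nonneg: "0 \<le> path_weight X L f s"
  by (induction L arbitrary: s) auto

lemma path_weight_upd: "i \<notin> set L \<Longrightarrow> path_weight X L (f(i := p)) s = path_weight X L f s"
  by (induction L arbitrary: s) auto

lemma sum_PiE_insert:
  assumes "i \<notin> A"
  shows "(\<Sum>f\<in>PiE (insert i A) E. h f) = (\<Sum>p\<in>E i. \<Sum>f\<in>PiE A E. h (f(i := p)))"
proof -
  have "(\<Sum>f\<in>PiE (insert i A) E. h f) = (\<Sum>v\<in>E i \<times> PiE A E. h ((\<lambda>(p, f). f(i := p)) v))"
    unfolding PiE_insert_eq by (rule sum.reindex[OF inj_combinator[OF assms], unfolded o_def])
  also have "\<dots> = (\<Sum>p\<in>E i. \<Sum>f\<in>PiE A E. h (f(i := p)))"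
    by (simp add: sum.cartesian_product split_def)
  finally show ?thesis .
qed

lemma step_cost_nonneg: "1 \<le> N \<Longrightarrow> 0 \<le> step_cost U B N"
  by (simp add: step_cost_def)

text \<open>Induction along the list. The bound for the tail, started at the new partial sum,
  supplies the reciprocal denominator that \<open>step_bound\<close> sums, and the division by
  \<open>tau (denom s) ^ 2\<close> in the weight cancels the loss there. At the end the indicator of
  denominator 1 is at most \<open>1 / denom s\<close>.\<close>

lemma sum_path_weight_le:
  assumes "distinct L" "\<And>i. i \<in> set L \<Longrightarrow> B i \<subseteq> {1..N i} \<and> 1 \<le> N i"
  shows "(\<Sum>f\<in>PiE (set L) (\<lambda>i. reduced_pairs (B i) (N i)). path_weight X L f s)
    \<le> (\<Prod>i\<in>set L. step_cost (i \<in> X) (B i) (N i) * (1 + ln (real_of_int (N i)))) / real_of_int (denom s)"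
  using assms
proof (induction L arbitrary: s)
  case Nil
  then show ?case using denom_pos[of s] by simp
next
  case (Cons i L)
  let ?E = "\<lambda>i. reduced_pairs (B i) (N i)"
  let ?c = "\<lambda>i. step_cost (i \<in> X) (B i) (N i) * (1 + ln (real_of_int (N i)))"
  let ?up = "\<lambda>p. i \<in> X \<longrightarrow> denom s \<le> denom (s + frac_of p)"
  let ?T = "real (tau (denom s)) ^ 2"
  have iL: "i \<notin> set L" and Bi: "B i \<subseteq> {1..N i}" "1 \<le> N i" using Cons.prems by auto
  have fE: "finite (?E i)" using Bi finite_subset by (intro finite_reduced_pairs) blast
  have T: "0 < ?T" using tau_ge_1[OF denom_pos[of s]] by simp
  have C: "0 \<le> (\<Prod>i\<in>set L. ?c i)"
    using Cons.prems by (intro prod_nonneg mult_nonneg_nonneg step_cost_nonneg add_nonneg_nonneg ln_ge_zero ballI) auto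
  have "(\<Sum>f\<in>PiE (set (i # L)) ?E. path_weight X (i # L) f s)
      = (\<Sum>p\<in>?E i. if ?up p then (\<Sum>f\<in>PiE (set L) ?E. path_weight X L f (s + frac_of p)) / ?T else 0)"
    using iL by (simp add: sum_PiE_insert path_weight_upd sum_divide_distrib if_distrib[of sum] cong: if_cong)
      (intro sum.cong refl, auto)
  also have "\<dots> \<le> (\<Sum>p\<in>?E i. if ?up p then ((\<Prod>i\<in>set L. ?c i) / ?T) * (1 / real_of_int (denom (s + frac_of p))) else 0)"
  proof (rule sum_mono)
    fix p
    show "(if ?up p then (\<Sum>f\<in>PiE (set L) ?E. path_weight X L f (s + frac_of p)) / ?T else 0)
      \<le> (if ?up p then ((\<Prod>i\<in>set L. ?c i) / ?T) * (1 / real_of_int (denom (s + frac_of p))) else 0)"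
      using divide_right_mono[OF Cons.IH[of "s + frac_of p"], of ?T] Cons.prems T by (auto simp: mult.commute)
  qed
  also have "\<dots> = ((\<Prod>i\<in>set L. ?c i) / ?T) * (\<Sum>p | p \<in> ?E i \<and> ?up p. 1 / real_of_int (denom (s + frac_of p)))"
    using fE by (simp add: sum_distrib_left sum.inter_filter[symmetric])
  also have "\<dots> \<le> ((\<Prod>i\<in>set L. ?c i) / ?T) * (?T * (?c i / real_of_int (denom s)))"
    using C T by (intro mult_left_mono step_bound[OF Bi]) auto
  also have "\<dots> = (\<Prod>i\<in>set (i # L). ?c i) / real_of_int (denom s)"
    using iL T by (simp add: ac_simps)
  finally show ?case .
qed

text \<open>The first fraction is subject to no congruence, so its numerator is free in
  \<open>B i\<close>. The tail contributes \<open>1 / q\<close> for its denominator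
  \<open>q\<close>, which turns the weight \<open>tau q ^ m\<close> into a logarithmic moment. The
  bound \<open>card (B i) \<le> N i\<close> covers the case where \<open>i\<close> is not in
  \<open>X\<close>.\<close>

lemma sum_weighted_paths_le:
  assumes "distinct (i # L)" "\<And>j. j \<in> set (i # L) \<Longrightarrow> B j \<subseteq> {1..N j} \<and> 1 \<le> N j"
  shows "(\<Sum>f\<in>PiE (set (i # L)) (\<lambda>j. reduced_pairs (B j) (N j)).
      real (tau (snd (f i))) ^ m * path_weight X L f (frac_of (f i)))
    \<le> step_cost (i \<in> X) (B i) (N i) * (1 + ln (real_of_int (N i))) ^ (2 ^ m) *
      (\<Prod>j\<in>set L. step_cost (j \<in> X) (B j) (N j) * (1 + ln (real_of_int (N j))))"
    (is "_ \<le> _ * ?C")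
proof -
  let ?E = "\<lambda>j. reduced_pairs (B j) (N j)"
  have iL: "i \<notin> set L" and Bi: "B i \<subseteq> {1..N i}" "1 \<le> N i" using assms by auto
  have fB: "finite (B i)" using Bi finite_subset by blast
  have C: "0 \<le> ?C"
    using assms by (intro prod_nonneg mult_nonneg_nonneg step_cost_nonneg add_nonneg_nonneg ln_ge_zero ballI) auto
  have "(\<Sum>f\<in>PiE (set (i # L)) ?E. real (tau (snd (f i))) ^ m * path_weight X L f (frac_of (f i)))
      = (\<Sum>p\<in>?E i. real (tau (snd p)) ^ m * (\<Sum>f\<in>PiE (set L) ?E. path_weight X L f (frac_of p)))"
    using iL by (simp add: sum_PiE_insert path_weight_upd sum_distrib_left)
  also have "\<dots> \<le> (\<Sum>p\<in>?E i. real (tau (snd p)) ^ m * (?C / real_of_int (snd p)))"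
  proof (rule sum_mono)
    fix p assume "p \<in> ?E i"
    then show "real (tau (snd p)) ^ m * (\<Sum>f\<in>PiE (set L) ?E. path_weight X L f (frac_of p))
      \<le> real (tau (snd p)) ^ m * (?C / real_of_int (snd p))"
      using sum_path_weight_le[of L B N X "frac_of p"] assms
      by (intro mult_left_mono) (auto simp: denom_frac_of)
  qed
  also have "\<dots> \<le> (\<Sum>p\<in>B i \<times> {1..N i}. real (tau (snd p)) ^ m * (?C / real_of_int (snd p)))"
    using fB C by (intro sum_mono2) (auto simp: reduced_pairs_def)
  also have "\<dots> = real (card (B i)) * (\<Sum>q\<in>{1..N i}. real (tau q) ^ m * (?C / real_of_int q))"
    by (simp only: sum.cartesian_product' snd_conv sum_constant)
  also have "(\<Sum>q\<in>{1..N i}. real (tau q) ^ m * (?C / real_of_int q))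
      = ?C * (\<Sum>q\<in>{1..N i}. real (tau q) ^ m / real_of_int q)"
    unfolding sum_distrib_left by (intro sum.cong refl) simp
  also have "real (card (B i)) * \<dots> \<le> step_cost (i \<in> X) (B i) (N i) * (?C * (1 + ln (real_of_int (N i))) ^ (2 ^ m))"
  proof (intro mult_mono mult_left_mono sum_tau_power_le)
    have "card (B i) \<le> card {1..N i}" using Bi by (intro card_mono) auto
    then show "real (card (B i)) \<le> step_cost (i \<in> X) (B i) (N i)"
      using Bi by (auto simp: step_cost_def)
  qed (use C Bi in \<open>auto intro!: mult_nonneg_nonneg sum_nonneg step_cost_nonneg\<close>)
  finally show ?thesis by (simp add: ac_simps)
qed

section \<open>Lower bound for the weight of one path\<close>

abbreviation path_sum :: "('i \<Rightarrow> int \<times> int) \<Rightarrow> 'i list \<Rightarrow> rat"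
  where "path_sum f L \<equiv> sum_list (map (\<lambda>i. frac_of (f i)) L)"

text \<open>Under these conditions every test in the weight succeeds, so it is a product of
  \<open>length L\<close> factors \<open>1 / tau ^ 2\<close>, each at least
  \<open>1 / M ^ 2\<close>.\<close>

lemma path_weight_ge:
  assumes "\<And>A i R. L = A @ i # R \<Longrightarrow> i \<in> X \<Longrightarrow>
      denom (s + path_sum f A) \<le> denom (s + path_sum f A + frac_of (f i))"
    and "\<And>A R. L = A @ R \<Longrightarrow> real (tau (denom (s + path_sum f A))) \<le> M"
    and "denom (s + path_sum f L) = 1"
  shows "1 \<le> M ^ (2 * length L) * path_weight X L f s"
  using assms
proof (induction L arbitrary: s)
  case Nil
  then show ?case by simp
next
  case (Cons i L)
  have IH: "1 \<le> M ^ (2 * length L) * path_weight X L f (s + frac_of (f i))"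
  proof (rule Cons.IH)
    fix A j R assume "L = A @ j # R" "j \<in> X"
    then show "denom (s + frac_of (f i) + path_sum f A) \<le> denom (s + frac_of (f i) + path_sum f A + frac_of (f j))"
      using Cons.prems(1)[of "i # A" j R] by (simp add: add.assoc)
  next
    fix A R assume "L = A @ R"
    then show "real (tau (denom (s + frac_of (f i) + path_sum f A))) \<le> M"
      using Cons.prems(2)[of "i # A" R] by (simp add: add.assoc)
  qed (use Cons.prems(3) in \<open>simp add: add.assoc\<close>)
  have T: "0 < real (tau (denom s))" "real (tau (denom s)) \<le> M"
    using tau_ge_1[OF denom_pos[of s]] Cons.prems(2)[of "[]"] by auto
  have "1 \<le> (M / real (tau (denom s))) ^ 2" using T by simp
  then have "1 * 1 \<le> (M / real (tau (denom s))) ^ 2 * (M ^ (2 * length L) * path_weight X L f (s + frac_of (f i)))"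
    using IH by (intro mult_mono) auto
  then show ?case using Cons.prems(1)[of "[]" i L] T
    by (simp add: power_divide power_add ac_simps power2_eq_square)
qed

section \<open>Choosing the order\<close>

definition ups :: "('i \<Rightarrow> int \<times> int) \<Rightarrow> 'i list \<Rightarrow> 'i set"
  where "ups f L = {i. \<exists>A R. L = A @ i # R \<and> denom (path_sum f A) \<le> denom (path_sum f A + frac_of (f i))}"

lemma finite_ups: "finite (ups f L)"
  by (rule finite_subset[of _ "set L"]) (auto simp: ups_def)

text \<open>Modulo 1, what follows \<open>i\<close> is minus the partial sum through
  \<open>i\<close>. Reversal therefore exchanges the denominators before and after the step at
  \<open>i\<close>, turning a decrease into an increase.\<close>

lemma ups_rev:
  assumes "path_sum f L \<in> \<int>"
  shows "set L \<subseteq> ups f L \<union> ups f (rev L)"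
proof
  fix i assume "i \<in> set L"
  then obtain A R where L: "L = A @ i # R" by (meson split_list)
  define p where "p = path_sum f A"
  define r where "r = frac_of (f i)"
  have int: "p + r + path_sum f R \<in> \<int>" using assms by (simp add: L p_def r_def add.assoc)
  have rs: "path_sum f (rev R) = path_sum f R" by (simp add: rev_map[symmetric])
  have "path_sum f R = (p + r + path_sum f R) + - (p + r)" by simp
  then have 1: "denom (path_sum f R) = denom (p + r)"
    using denom_add_int[OF int] denom_uminus by metis
  have "path_sum f R + r = (p + r + path_sum f R) + - p" by simp
  then have 2: "denom (path_sum f R + r) = denom p"
    using denom_add_int[OF int] denom_uminus by metis
  show "i \<in> ups f L \<union> ups f (rev L)"
  proof (cases "denom p \<le> denom (p + r)")
    case True
    then show ?thesis unfolding ups_def p_def r_def using L by auto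
  next
    case False
    then have "denom (path_sum f (rev R)) \<le> denom (path_sum f (rev R) + r)" using 1 2 rs by simp
    moreover have "rev L = rev R @ i # rev A" by (simp add: L)
    ultimately show ?thesis unfolding ups_def r_def by blast
  qed
qed

text \<open>Whichever direction of the order is used, its head must control all divisor losses;
  hence the two largest values of \<open>tau\<close> go to the two ends. The result charges the
  whole weight to a power of \<open>tau\<close> of the first denominator.\<close>

lemma exists_good_path:
  assumes "finite I" "card I = 2 * k + 1" "1 \<le> k"
    and f: "\<And>i. i \<in> I \<Longrightarrow> coprime (fst (f i)) (snd (f i)) \<and> 0 < snd (f i)"
    and int: "(\<Sum>i\<in>I. frac_of (f i)) \<in> \<int>"
  obtains L X where "set L = I" "distinct L" "X \<subseteq> I" "card X = k + 1"
    "1 \<le> real (tau (snd (f (hd L)))) ^ (2 * card I ^ 3) * path_weight X (tl L) f (frac_of (f (hd L)))"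
proof -
  define n where "n = card I"
  define T where "T i = tau (snd (f i))" for i
  have den: "denom (frac_of (f i)) = snd (f i)" if "i \<in> I" for i
    using f[OF that] by (simp add: frac_of_def denom_divide)
  have T1: "1 \<le> T i" if "i \<in> I" for i
    using f[OF that] tau_ge_1[of "snd (f i)"] by (simp add: T_def)
  have n: "3 \<le> n" using assms by (simp add: n_def)
  have "I \<noteq> {}" using n by (auto simp: n_def)
  then obtain i0 where i0: "i0 \<in> I" "\<And>i. i \<in> I \<Longrightarrow> T i \<le> T i0"
    using obtains_MAX[OF assms(1)] Max_ge[of "T ` I"] assms(1) by (metis finite_imageI imageI)
  have "card (I - {i0}) \<noteq> 0" using i0 assms by (simp add: n_def)
  then have "I - {i0} \<noteq> {}" by force
  then obtain j0 where j0: "j0 \<in> I - {i0}" "\<And>i. i \<in> I - {i0} \<Longrightarrow> T i \<le> T j0"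
    using obtains_MAX[of "I - {i0}"] Max_ge[of "T ` (I - {i0})"] assms(1)
    by (metis finite_Diff finite_imageI imageI)
  define K where "K = real (T i0)"
  have K1: "1 \<le> K" using T1 i0 by (simp add: K_def)
  \<comment> \<open>Since the total is an integer, the denominator at \<open>i0\<close> is that of
    the sum of the other fractions, so it divides the product of their denominators, each having at
    most \<open>T j0\<close> divisors.\<close>
  have Kj: "T i0 \<le> T j0 ^ n"
  proof -
    let ?s = "\<Sum>i\<in>I - {i0}. frac_of (f i)"
    have "frac_of (f i0) = (\<Sum>i\<in>I. frac_of (f i)) + - ?s"
      using i0 assms(1) by (simp add: sum.remove)
    then have "snd (f i0) = denom ?s"
      using den[OF i0(1)] denom_add_int[OF int] denom_uminus by metis
    also have "\<dots> dvd (\<Prod>i\<in>I - {i0}. denom (frac_of (f i)))"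
      using assms(1) by (intro denom_sum_dvd) auto
    also have "\<dots> = (\<Prod>i\<in>I - {i0}. snd (f i))" using den by (intro prod.cong) auto
    finally have "T i0 \<le> tau (\<Prod>i\<in>I - {i0}. snd (f i))"
      unfolding T_def using f by (intro tau_mono prod_pos) auto
    also have "\<dots> \<le> (\<Prod>i\<in>I - {i0}. T i)"
      unfolding T_def using f assms(1) by (intro tau_prod_le) auto
    also have "\<dots> \<le> (\<Prod>i\<in>I - {i0}. T j0)" using j0 by (intro prod_mono) auto
    also have "\<dots> = T j0 ^ card (I - {i0})" by simp
    also have "\<dots> \<le> T j0 ^ n"
      using T1[of j0] j0 assms(1) unfolding n_def by (intro power_increasing card_mono) auto
    finally show ?thesis .
  qed
  have Ki: "T i0 \<le> T i0 ^ n" using T1[OF i0(1)] n by (simp add: self_le_power)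
  obtain xs where xs: "set xs = I - {i0, j0}" "distinct xs"
    using finite_distinct_list[of "I - {i0, j0}"] assms(1) by auto
  define L0 where "L0 = i0 # xs @ [j0]"
  have L0: "set L0 = I" "distinct L0" using xs i0 j0 by (auto simp: L0_def)
  have "path_sum f L0 = (\<Sum>i\<in>I. frac_of (f i))" using L0 by (metis sum_list_distinct_conv_sum_set)
  with int have intL: "path_sum f L0 \<in> \<int>" by simp
  have "2 * k + 1 = card (set L0)" using L0 assms by simp
  also have "\<dots> \<le> card (ups f L0 \<union> ups f (rev L0))"
    using ups_rev[OF intL] finite_ups by (intro card_mono) auto
  also have "\<dots> \<le> card (ups f L0) + card (ups f (rev L0))" by (rule card_Un_le)
  finally have "k + 1 \<le> card (ups f L0) \<or> k + 1 \<le> card (ups f (rev L0))" by linarith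
  moreover have "T i0 \<le> T (hd L0) ^ n" "T i0 \<le> T (hd (rev L0)) ^ n" using Ki Kj by (simp_all add: L0_def)
  moreover have "path_sum f (rev L0) \<in> \<int>" using intL by (simp add: rev_map[symmetric])
  ultimately obtain L where L: "set L = I" "distinct L" "k + 1 \<le> card (ups f L)" "T i0 \<le> T (hd L) ^ n"
      "path_sum f L \<in> \<int>"
    using L0 intL by (metis set_rev distinct_rev)
  \<comment> \<open>Surplus non-decreasing steps may be left out of \<open>X\<close>, because the
    weight imposes no condition outside \<open>X\<close>.\<close>
  obtain X where X: "X \<subseteq> ups f L" "card X = k + 1" using obtain_subset_with_card_n[OF L(3)] by blast
  have "X \<subseteq> I" using X(1) L(1) by (auto simp: ups_def)
  have lenL: "length L = n" using L distinct_card[of L] by (simp add: n_def)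
  have "1 \<le> (K ^ n) ^ (2 * length L) * path_weight X L f 0"
  proof (rule path_weight_ge)
    fix A i R assume dec: "L = A @ i # R" "i \<in> X"
    then obtain A' R' where A': "L = A' @ i # R'"
      "denom (path_sum f A') \<le> denom (path_sum f A' + frac_of (f i))"
      using X by (auto simp: ups_def)
    \<comment> \<open>By distinctness the splitting that witnesses \<open>i\<close> in
      \<open>ups f L\<close> is the given one.\<close>
    have "i \<notin> set A" "i \<notin> set R" using L(2) dec by auto
    then have "A = A'" using append_Cons_eq_iff[of i A R A' R'] dec(1) A'(1) by simp
    then show "denom (0 + path_sum f A) \<le> denom (0 + path_sum f A + frac_of (f i))" using A' by simp
  next
    fix A R assume dec: "L = A @ R"
    then have A: "distinct A" "set A \<subseteq> I" using L by auto
    then have fA: "finite (set A)" by simp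
    have "denom (path_sum f A) = denom (\<Sum>i\<in>set A. frac_of (f i))"
      using A by (simp add: sum_list_distinct_conv_sum_set)
    also have "\<dots> dvd (\<Prod>i\<in>set A. denom (frac_of (f i)))" by (intro denom_sum_dvd fA)
    also have "\<dots> = (\<Prod>i\<in>set A. snd (f i))" using den A by (intro prod.cong) auto
    finally have "tau (denom (path_sum f A)) \<le> tau (\<Prod>i\<in>set A. snd (f i))"
      using f A by (intro tau_mono prod_pos) auto
    also have "\<dots> \<le> (\<Prod>i\<in>set A. T i)" unfolding T_def using f A by (intro tau_prod_le) auto
    also have "\<dots> \<le> (\<Prod>i\<in>set A. T i0)" using i0 A by (intro prod_mono) auto
    also have "\<dots> = T i0 ^ card (set A)" by simp
    also have "\<dots> \<le> T i0 ^ n"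
      using T1[of i0] i0 A assms(1) unfolding n_def by (intro power_increasing card_mono) auto
    finally show "real (tau (denom (0 + path_sum f A))) \<le> K ^ n"
      by (simp add: K_def flip: of_nat_power)
  next
    show "denom (0 + path_sum f L) = 1" using L(5) by (simp add: denom_eq_1_iff)
  qed
  \<comment> \<open>The exponents: \<open>2 * n\<close> factors \<open>K ^ n\<close>, followed by
    \<open>K \<le> T (hd L) ^ n\<close>, give \<open>2 * n ^ 3\<close>.\<close>
  also have "(K ^ n) ^ (2 * length L) = K ^ (2 * n ^ 2)"
    by (simp add: lenL power2_eq_square ac_simps flip: power_mult)
  also have "K ^ (2 * n ^ 2) * path_weight X L f 0 \<le> (real (T (hd L)) ^ n) ^ (2 * n ^ 2) * path_weight X L f 0"
    using L(4) K1 unfolding K_def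
    by (intro mult_right_mono power_mono path_weight_nonneg) (auto simp flip: of_nat_power)
  also have "(real (T (hd L)) ^ n) ^ (2 * n ^ 2) = real (T (hd L)) ^ (2 * n ^ 3)"
    by (simp add: power2_eq_square power3_eq_cube ac_simps flip: power_mult)
  \<comment> \<open>The start 0 has denominator 1 and \<open>tau 1 = 1\<close>, so splitting off the
    first step loses nothing.\<close>
  also have "path_weight X L f 0 \<le> path_weight X (tl L) f (frac_of (f (hd L)))"
  proof -
    obtain h L' where "L = h # L'" using lenL n by (cases L) auto
    moreover have "denom 0 = 1" using denom_of_int[of 0] by simp
    moreover have "tau 1 = 1" using tau_prod_le[of "{}"] tau_ge_1[of 1] by simp
    ultimately show ?thesis using path_weight_nonneg by auto
  qed
  finally show thesis
    using that[OF L(1,2) \<open>X \<subseteq> I\<close> X(2)] unfolding T_def n_def by (simp add: mult_left_mono)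
qed

text \<open>This makes the bound uniform in the order. Each \<open>N i\<close> is at most the
  product of all \<open>Q i\<close>, the other factors being at least 1, so one logarithm serves for
  all. The head contributes the exponent \<open>2 ^ m\<close>, and the remaining steps at most
  \<open>card I\<close>.\<close>

lemma sum_path_class_le:
  fixes Q :: "'i \<Rightarrow> real"
  assumes L: "set L = I" "distinct L" "L \<noteq> []" and "X \<subseteq> I"
    and BN: "\<And>i. i \<in> I \<Longrightarrow> B i \<subseteq> {1..N i} \<and> 1 \<le> N i \<and> real_of_int (N i) \<le> Q i"
  shows "(\<Sum>f\<in>PiE I (\<lambda>i. reduced_pairs (B i) (N i)).
      real (tau (snd (f (hd L)))) ^ m * path_weight X (tl L) f (frac_of (f (hd L))))
    \<le> 2 ^ card I * ((\<Prod>i\<in>X. real (card (B i))) * (\<Prod>j\<in>I - X. Q j)) * (1 + ln (\<Prod>i\<in>I. Q i)) ^ (2 ^ m + card I)"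
proof -
  define \<Lambda> where "\<Lambda> = ln (\<Prod>i\<in>I. Q i)"
  let ?c = "\<lambda>i. step_cost (i \<in> X) (B i) (N i)"
  let ?l = "\<lambda>i. 1 + ln (real_of_int (N i))"
  obtain h T where hT: "L = h # T" using L(3) by (cases L) auto
  have fI: "finite I" using L by auto
  have N1: "1 \<le> real_of_int (N i)" "1 \<le> Q i" if "i \<in> I" for i using BN[OF that] by auto
  have c0: "0 \<le> ?c i" if "i \<in> I" for i using BN[OF that] by (simp add: step_cost_nonneg)
  have l: "1 \<le> ?l i" "?l i \<le> 1 + \<Lambda>" if i: "i \<in> I" for i
  proof -
    show "1 \<le> ?l i" using N1[OF i] by simp
    have "real_of_int (N i) \<le> Q i" using BN[OF i] by simp
    also have "\<dots> \<le> (\<Prod>i\<in>I. Q i)"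
    proof -
      have "1 \<le> (\<Prod>i\<in>I - {i}. Q i)" using N1 by (intro prod_ge_1) auto
      then show ?thesis using N1[OF i] fI i by (simp add: prod.remove mult_le_cancel_left1)
    qed
    finally show "?l i \<le> 1 + \<Lambda>" using N1[OF i] by (simp add: \<Lambda>_def)
  qed
  have hI: "h \<in> I" "I = insert h (set T)" "h \<notin> set T" using L hT by auto
  have \<Lambda>: "0 \<le> \<Lambda>" using l[OF hI(1)] by simp
  have "(\<Sum>f\<in>PiE I (\<lambda>i. reduced_pairs (B i) (N i)).
      real (tau (snd (f (hd L)))) ^ m * path_weight X (tl L) f (frac_of (f (hd L))))
      \<le> ?c h * ?l h ^ (2 ^ m) * (\<Prod>j\<in>set T. ?c j * ?l j)"
  proof -
    have "B j \<subseteq> {1..N j} \<and> 1 \<le> N j" if "j \<in> set (h # T)" for j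
    proof -
      have "j \<in> I" using that hI by auto
      then show ?thesis using BN by simp
    qed
    from sum_weighted_paths_le[of h T B N m X, OF _ this] show ?thesis using L hT by simp
  qed
  also have "\<dots> = (\<Prod>j\<in>I. ?c j) * (?l h ^ (2 ^ m) * (\<Prod>j\<in>set T. ?l j))"
    using hI by (simp add: prod.distrib ac_simps)
  also have "\<dots> \<le> (\<Prod>j\<in>I. ?c j) * ((1 + \<Lambda>) ^ (2 ^ m) * (1 + \<Lambda>) ^ card I)"
  proof (intro mult_left_mono mult_mono power_mono)
    have "(\<Prod>j\<in>set T. ?l j) \<le> (\<Prod>j\<in>set T. 1 + \<Lambda>)"
    proof (intro prod_mono)
      fix j assume "j \<in> set T"
      then have "j \<in> I" using hI by auto
      from l[OF this] show "0 \<le> ?l j \<and> ?l j \<le> 1 + \<Lambda>" by linarith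
    qed
    also have "\<dots> \<le> (1 + \<Lambda>) ^ card I"
      using \<Lambda> hI fI by (simp add: power_increasing card_mono)
    finally show "(\<Prod>j\<in>set T. ?l j) \<le> (1 + \<Lambda>) ^ card I" .
    show "0 \<le> (\<Prod>j\<in>set T. ?l j)"
    proof (intro prod_nonneg)
      fix j assume "j \<in> set T"
      then have "j \<in> I" using hI by auto
      from l[OF this] show "0 \<le> ?l j" by linarith
    qed
  qed (use l[OF hI(1)] \<Lambda> c0 in \<open>auto intro!: prod_nonneg\<close>)
  also have "(1 + \<Lambda>) ^ (2 ^ m) * (1 + \<Lambda>) ^ card I = (1 + \<Lambda>) ^ (2 ^ m + card I)"
    by (simp add: power_add)
  also have "(\<Prod>j\<in>I. ?c j) * (1 + \<Lambda>) ^ (2 ^ m + card I)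
      \<le> 2 ^ card I * ((\<Prod>i\<in>X. real (card (B i))) * (\<Prod>j\<in>I - X. Q j)) * (1 + \<Lambda>) ^ (2 ^ m + card I)"
  proof (rule mult_right_mono)
    \<comment> \<open>The factor 2 is granted to the indices in \<open>X\<close> as well, giving
      \<open>2 ^ card I\<close>.\<close>
    have "(\<Prod>j\<in>I. ?c j) \<le> (\<Prod>j\<in>I. 2 * (if j \<in> X then real (card (B j)) else Q j))"
      using BN c0 by (intro prod_mono) (auto simp: step_cost_def)
    also have "\<dots> = 2 ^ card I * (\<Prod>j\<in>I. if j \<in> X then real (card (B j)) else Q j)"
      by (simp add: prod.distrib)
    also have "(\<Prod>j\<in>I. if j \<in> X then real (card (B j)) else Q j)
        = (\<Prod>i\<in>X. real (card (B i))) * (\<Prod>j\<in>I - X. Q j)"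
    proof -
      have "I \<inter> {j. j \<in> X} = X" "I \<inter> - {j. j \<in> X} = I - X" using assms(4) by auto
      then show ?thesis using fI by (simp add: prod.If_cases)
    qed
    finally show "(\<Prod>j\<in>I. ?c j) \<le> 2 ^ card I * ((\<Prod>i\<in>X. real (card (B i))) * (\<Prod>j\<in>I - X. Q j))" .
  qed (use \<Lambda> in simp)
  finally show ?thesis unfolding \<Lambda>_def .
qed

section \<open>Summing over all orders\<close>

text \<open>Passes to rational sums, where reduced denominators are available, and to integer
  bounds. Merging the two functions into one with values in pairs is injective because both are
  extensional on \<open>I\<close>.\<close>

lemma card_solutions_le:
  assumes "finite I" "\<And>i. i \<in> I \<Longrightarrow> finite (B i)"
  shows "card (solutions I Q B)
    \<le> card {f \<in> PiE I (\<lambda>i. reduced_pairs (B i) \<lfloor>Q i\<rfloor>). (\<Sum>i\<in>I. frac_of (f i)) \<in> \<int>}" (is "_ \<le> card ?S")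
proof (rule card_inj_on_le)
  let ?\<phi> = "\<lambda>(a, q). restrict (\<lambda>i. (a i, q i)) I"
  show "inj_on ?\<phi> (solutions I Q B)"
  proof (rule inj_onI, clarify)
    fix a q a' q' assume sol: "(a, q) \<in> solutions I Q B" "(a', q') \<in> solutions I Q B"
      and eq: "restrict (\<lambda>i. (a i, q i)) I = restrict (\<lambda>i. (a' i, q' i)) I"
    have "a i = a' i \<and> q i = q' i" if "i \<in> I" for i using fun_cong[OF eq, of i] that by simp
    then show "a = a' \<and> q = q'"
      using sol by (auto simp: solutions_def intro: extensionalityI[of _ I])
  qed
  show "?\<phi> ` solutions I Q B \<subseteq> ?S"
  proof
    fix v assume "v \<in> ?\<phi> ` solutions I Q B"
    then obtain a q where "(a, q) \<in> solutions I Q B" and v: "v = restrict (\<lambda>i. (a i, q i)) I"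
      by auto
    then have aq: "\<And>i. i \<in> I \<Longrightarrow> a i \<in> B i \<and> 1 \<le> q i \<and> real_of_int (q i) \<le> Q i \<and> gcd (a i) (q i) = 1"
      and int: "(\<Sum>i\<in>I. real_of_int (a i) / real_of_int (q i)) \<in> \<int>"
      by (auto simp: solutions_def)
    let ?f = "restrict (\<lambda>i. (a i, q i)) I"
    have "real_of_rat (\<Sum>i\<in>I. frac_of (?f i)) = (\<Sum>i\<in>I. real_of_int (a i) / real_of_int (q i))"
      by (simp add: of_rat_sum frac_of_def of_rat_divide)
    with int obtain m where "real_of_rat (\<Sum>i\<in>I. frac_of (?f i)) = real_of_rat (of_int m)"
      by (auto elim!: Ints_cases)
    then have "(\<Sum>i\<in>I. frac_of (?f i)) = of_int m" by (simp only: of_rat_eq_iff)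
    then have "(\<Sum>i\<in>I. frac_of (?f i)) \<in> \<int>" by simp
    moreover have "?f \<in> PiE I (\<lambda>i. reduced_pairs (B i) \<lfloor>Q i\<rfloor>)"
      using aq by (auto simp: reduced_pairs_def le_floor_iff coprime_iff_gcd_eq_1)
    ultimately show "v \<in> ?S" unfolding v by blast
  qed
  have "finite (PiE I (\<lambda>i. reduced_pairs (B i) \<lfloor>Q i\<rfloor>))"
    using assms by (intro finite_PiE finite_reduced_pairs)
  then show "finite ?S" by simp
qed

theorem theorem2p2:
  fixes k :: nat
  assumes "k \<ge> 1"
  shows "\<exists>(C::real) (A::nat). C > 0 \<and>
    (\<forall>(Q :: nat \<Rightarrow> real) (B :: nat \<Rightarrow> int set).
      (\<forall>i\<in>{1..2*k+1}. Q i \<ge> 1 \<and> B i \<subseteq> {b. 1 \<le> b \<and> real_of_int b \<le> Q i}) \<longrightarrow>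
      (\<exists>X Y. X \<union> Y = {1..2*k+1} \<and> X \<inter> Y = {} \<and> card X = k + 1 \<and> card Y = k \<and>
        (\<exists>e::nat. e \<le> A \<and>
          real (card (solutions {1..2*k+1} Q B))
            \<le> C * ln (\<Prod>i\<in>{1..2*k+1}. Q i) ^ e * (\<Prod>i\<in>X. real (card (B i))) * (\<Prod>j\<in>Y. Q j))))"
proof -
  define I where "I = {1..2 * k + 1}"
  \<comment> \<open>\<open>m\<close> is the power of \<open>tau\<close> from
    \<open>exists_good_path\<close>, and \<open>A\<close> the exponent it produces in
    \<open>sum_path_class_le\<close>.\<close>
  define m where "m = 2 * card I ^ 3"
  define A where "A = 2 ^ m + card I"
  \<comment> \<open>The orders with their sets \<open>X\<close> depend on \<open>k\<close> only, so
    their number may enter the constant; the added 1 in \<open>C\<close> makes it visibly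
    positive.\<close>
  define P where "P = {(L :: nat list, X). set L = I \<and> distinct L \<and> X \<subseteq> I \<and> card X = k + 1}"
  define C where "C = real (card P + 1) * 2 ^ card I * 2 ^ A"
  have fI: "finite I" and cI: "card I = 2 * k + 1" by (simp_all add: I_def)
  have "P \<subseteq> {L. set L \<subseteq> I \<and> length L \<le> card I} \<times> Pow I"
    by (auto simp: P_def distinct_card[symmetric])
  then have fP: "finite P"
    using finite_subset finite_lists_length_le[OF fI] fI by (metis finite_Pow_iff finite_SigmaI)
  have "\<exists>X Y. X \<union> Y = I \<and> X \<inter> Y = {} \<and> card X = k + 1 \<and> card Y = k \<and>
        (\<exists>e\<le>A. real (card (solutions I Q B))
            \<le> C * ln (\<Prod>i\<in>I. Q i) ^ e * (\<Prod>i\<in>X. real (card (B i))) * (\<Prod>j\<in>Y. Q j))"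
    if QB: "\<forall>i\<in>I. Q i \<ge> 1 \<and> B i \<subseteq> {b. 1 \<le> b \<and> real_of_int b \<le> Q i}"
    for Q :: "nat \<Rightarrow> real" and B :: "nat \<Rightarrow> int set"
  proof -
    define N where "N i = \<lfloor>Q i\<rfloor>" for i
    define \<Lambda> where "\<Lambda> = ln (\<Prod>i\<in>I. Q i)"
    define V where "V X = (\<Prod>i\<in>X. real (card (B i))) * (\<Prod>j\<in>I - X. Q j)" for X
    define E where "E = (\<lambda>i. reduced_pairs (B i) (N i))"
    define S where "S = {f \<in> PiE I E. (\<Sum>i\<in>I. frac_of (f i)) \<in> \<int>}"
    define g where "g f = (\<lambda>(L, X). real (tau (snd (f (hd L)))) ^ m * path_weight X (tl L) f (frac_of (f (hd L))))"
      for f :: "nat \<Rightarrow> int \<times> int"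
    have BN: "B i \<subseteq> {1..N i} \<and> 1 \<le> N i \<and> real_of_int (N i) \<le> Q i" if "i \<in> I" for i
      using bspec[OF QB that] by (auto simp: N_def le_floor_iff)
    then have fB: "finite (B i)" if "i \<in> I" for i using that finite_subset by blast
    have fE: "finite (PiE I E)" unfolding E_def using fI fB by (intro finite_PiE finite_reduced_pairs) auto
    have g0: "0 \<le> g f p" for f p by (auto simp: g_def path_weight_nonneg split: prod.split)
    have "1 \<le> (\<Prod>i\<in>I. Q i)" using QB by (intro prod_ge_1) auto
    then have \<Lambda>: "0 \<le> \<Lambda>" by (simp add: \<Lambda>_def)
    have "\<exists>X. X \<subseteq> I \<and> card X = k + 1" using obtain_subset_with_card_n[of "k + 1" I] cI by auto
    then have ne: "V ` {X. X \<subseteq> I \<and> card X = k + 1} \<noteq> {}" by blast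
    have fV: "finite (V ` {X. X \<subseteq> I \<and> card X = k + 1})" using fI by simp
    \<comment> \<open>The path selects a set that varies with the solution, whereas the partition
      must be fixed. Maximising \<open>V\<close> gives one set whose bound dominates all
      others.\<close>
    obtain X where X: "X \<subseteq> I" "card X = k + 1" and "V X = Max (V ` {X. X \<subseteq> I \<and> card X = k + 1})"
      using Max_in[OF fV ne] by auto
    then have max: "V X' \<le> V X" if "X' \<subseteq> I" "card X' = k + 1" for X'
      using Max_ge[OF fV, of "V X'"] that by auto
    have V0: "0 \<le> V X" using QB by (fastforce simp: V_def intro!: mult_nonneg_nonneg prod_nonneg)
    have "real (card (solutions I Q B)) \<le> real (card S)"
      using card_solutions_le[where I = I and B = B and Q = Q] fI fB by (simp add: S_def E_def N_def)
    also have "\<dots> = (\<Sum>f\<in>S. 1)" by simp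
    \<comment> \<open>Some pair in \<open>P\<close> gives the solution weight at least 1. All
      weights being nonnegative, every pair may be summed, and afterwards all of
      \<open>PiE I E\<close>.\<close>
    also have "\<dots> \<le> (\<Sum>f\<in>S. \<Sum>p\<in>P. g f p)"
    proof (rule sum_mono)
      fix f assume f: "f \<in> S"
      have "coprime (fst (f i)) (snd (f i)) \<and> 0 < snd (f i)" if "i \<in> I" for i
      proof -
        have "f i \<in> reduced_pairs (B i) (N i)" using f that by (auto simp: S_def E_def)
        then show ?thesis by (auto simp: reduced_pairs_def)
      qed
      moreover have "(\<Sum>i\<in>I. frac_of (f i)) \<in> \<int>" using f by (simp add: S_def)
      ultimately obtain L X' where "(L, X') \<in> P" "1 \<le> g f (L, X')"
        by (rule exists_good_path[OF fI cI assms]) (auto simp: P_def g_def m_def)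
      then show "1 \<le> (\<Sum>p\<in>P. g f p)" using member_le_sum[of _ P "g f"] g0 fP by (meson order_trans)
    qed
    also have "\<dots> \<le> (\<Sum>f\<in>PiE I E. \<Sum>p\<in>P. g f p)"
      using fE g0 by (intro sum_mono2 sum_nonneg) (auto simp: S_def)
    also have "\<dots> = (\<Sum>p\<in>P. \<Sum>f\<in>PiE I E. g f p)" by (rule sum.swap)
    also have "\<dots> \<le> (\<Sum>p\<in>P. 2 ^ card I * V X * (1 + \<Lambda>) ^ A)"
    proof (rule sum_mono)
      fix p assume "p \<in> P"
      then obtain L X' where p: "p = (L, X')" "set L = I" "distinct L" "X' \<subseteq> I" "card X' = k + 1"
        by (auto simp: P_def)
      have "L \<noteq> []" using p(2) by (auto simp: I_def)
      have "(\<Sum>f\<in>PiE I E. g f p) \<le> 2 ^ card I * V X' * (1 + \<Lambda>) ^ A"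
        using sum_path_class_le[where m = m, OF p(2,3) \<open>L \<noteq> []\<close> p(4) BN]
        by (simp add: g_def p(1) E_def V_def A_def \<Lambda>_def)
      also have "\<dots> \<le> 2 ^ card I * V X * (1 + \<Lambda>) ^ A"
        using max[OF p(4,5)] \<Lambda> by (intro mult_right_mono mult_left_mono) auto
      finally show "(\<Sum>f\<in>PiE I E. g f p) \<le> 2 ^ card I * V X * (1 + \<Lambda>) ^ A" .
    qed
    also have "\<dots> \<le> real (card P + 1) * 2 ^ card I * V X * (1 + \<Lambda>) ^ A"
      using V0 \<Lambda> by (simp add: algebra_simps)
    finally have main: "real (card (solutions I Q B)) \<le> real (card P + 1) * 2 ^ card I * V X * (1 + \<Lambda>) ^ A" .
    \<comment> \<open>The exponent 0 is needed when the product of the \<open>Q i\<close> is close to 1.\<close>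
    obtain e where e: "e \<le> A" "(1 + \<Lambda>) ^ A \<le> 2 ^ A * \<Lambda> ^ e"
    proof (cases "1 \<le> \<Lambda>")
      case True
      then have "(1 + \<Lambda>) ^ A \<le> (2 * \<Lambda>) ^ A" by (intro power_mono) auto
      then show thesis using that[of A] by (simp add: power_mult_distrib)
    next
      case False
      then have "(1 + \<Lambda>) ^ A \<le> 2 ^ A" using \<Lambda> by (intro power_mono) auto
      then show thesis using that[of 0] by simp
    qed
    have "real (card P + 1) * 2 ^ card I * V X * (1 + \<Lambda>) ^ A \<le> real (card P + 1) * 2 ^ card I * V X * (2 ^ A * \<Lambda> ^ e)"
      using e(2) V0 by (intro mult_left_mono) auto
    with main have "real (card (solutions I Q B)) \<le> C * \<Lambda> ^ e * V X"
      by (simp add: C_def ac_simps)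
    moreover have "card (I - X) = k" using X cI fI by (simp add: card_Diff_subset finite_subset)
    ultimately show ?thesis
      using X e(1) unfolding \<Lambda>_def V_def
      by (intro exI[of _ X] exI[of _ "I - X"] conjI exI[of _ e]) (auto simp: mult.assoc)
  qed
  moreover have "0 < C" by (simp add: C_def)
  ultimately show ?thesis unfolding I_def by blast
qed

end
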